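(* Let $A,M,B$ be as in the context, and suppose that $\|I-M^{-1}A\|_B<1$, that $M^{-1}A$ is $B$-normal, and that $I-M^{-1}A$ is nonsingular. Let $\nu\in\mathbb{N}$ and let $n_c,\tilde n_c\in\mathbb{N}$ with $n_c\le\tilde n_c<n$. Let $P,R\in\mathbb{C}^{n\times n_c}$ and $\tilde P,\tilde R\in\mathbb{C}^{n\times\tilde n_c}$ be such that $R^HAP$ and $\tilde R^HA\tilde P$ are nonsingular and $\Pi_A(P,R)$ and $\Pi_A(\tilde P,\tilde R)$ are $B$-orthogonal. If $\mathcal R(R)\subseteq\mathcal R(\tilde R)$ or $\mathcal R(P)\subseteq\mathcal R(\tilde P)$, then $$\|E^{\nu_1,\nu_2}(\tilde P,\tilde R)\|_B\le\|E^{\nu_1,\nu_2}(P,R)\|_B$$ for any $(\nu_1,\nu_2)\in\{(\nu,0),(0,\nu),(\nu,\nu)\}$.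
   Context: $A\in\mathbb{C}^{n\times n}$ is nonsingular, $M^{-1}\in\mathbb{C}^{n\times n}$ is nonsingular, and $B\in\mathbb{C}^{n\times n}$ is Hermitian positive definite. $\|x\|_B=\sqrt{x^HBx}$ and $\|C\|_B=\sup_{x\ne0}\|Cx\|_B/\|x\|_B$. The $B$-adjoint of $C\in\mathbb{C}^{n\times n}$ is $C^+=B^{-1}C^HB$; $C$ is $B$-normal if $CC^+=C^+C$ and $B$-orthogonal if $C^+=C$. $\mathcal R(\cdot)$ denotes the range. $\mathbb{N}=\{1,2,\dots\}$. For $P,R$ with $R^HAP$ nonsingular, $\Pi_A(P,R)=P(R^HAP)^{-1}R^HA$, and for $\nu_1,\nu_2\in\mathbb{N}_0$, $$E^{\nu_1,\nu_2}(P,R)=(I-M^{-1}A)^{\nu_2}(I-\Pi_A(P,R))(I-M^{-1}A)^{\nu_1}.$$ *)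

theory Defs
  imports "HOL-Analysis.Analysis"
begin

text \<open>
  An m-by-k complex matrix has type \<open>complex ^ 'k ^ 'm\<close> (rows outermost), with matrix product \<open>**\<close>
  and identity \<open>mat 1\<close>. On this type the overloaded \<open>*\<close>, \<open>1\<close> and \<open>^\<close> are componentwise, hence the
  separate matrix power below.
\<close>

definition conj_transpose :: "complex ^ 'k ^ 'm \<Rightarrow> complex ^ 'm ^ 'k" where
  "conj_transpose A = map_matrix cnj (transpose A)"

primrec mat_power :: "complex ^ 'n ^ 'n \<Rightarrow> nat \<Rightarrow> complex ^ 'n ^ 'n" where
  "mat_power A 0 = mat 1"
| "mat_power A (Suc k) = A ** mat_power A k"

text \<open>The scalar \<open>x\<^sup>H B x\<close>; it is real when \<open>B\<close> is Hermitian.\<close>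

definition sesq_form :: "complex ^ 'n ^ 'n \<Rightarrow> complex ^ 'n \<Rightarrow> complex" where
  "sesq_form B x = (\<Sum>i\<in>UNIV. cnj (x $ i) * (B *v x) $ i)"

definition hermitian_pos_def :: "complex ^ 'n ^ 'n \<Rightarrow> bool" where
  "hermitian_pos_def B \<longleftrightarrow> conj_transpose B = B \<and> (\<forall>x. x \<noteq> 0 \<longrightarrow> 0 < Re (sesq_form B x))"

definition vec_norm_B :: "complex ^ 'n ^ 'n \<Rightarrow> complex ^ 'n \<Rightarrow> real" where
  "vec_norm_B B x = sqrt (Re (sesq_form B x))"

definition mat_norm_B :: "complex ^ 'n ^ 'n \<Rightarrow> complex ^ 'n ^ 'n \<Rightarrow> real" where
  "mat_norm_B B C = (SUP x\<in>{x. x \<noteq> 0}. vec_norm_B B (C *v x) / vec_norm_B B x)"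

definition adjoint_B :: "complex ^ 'n ^ 'n \<Rightarrow> complex ^ 'n ^ 'n \<Rightarrow> complex ^ 'n ^ 'n" where
  "adjoint_B B C = matrix_inv B ** conj_transpose C ** B"

definition normal_B :: "complex ^ 'n ^ 'n \<Rightarrow> complex ^ 'n ^ 'n \<Rightarrow> bool" where
  "normal_B B C \<longleftrightarrow> C ** adjoint_B B C = adjoint_B B C ** C"

text \<open>
  Following the terminology for projections, \<open>B\<close>-orthogonal means \<open>B\<close>-selfadjoint
  (not \<open>B\<close>-unitary).
\<close>

definition orthogonal_B :: "complex ^ 'n ^ 'n \<Rightarrow> complex ^ 'n ^ 'n \<Rightarrow> bool" where
  "orthogonal_B B C \<longleftrightarrow> adjoint_B B C = C"

definition coarse_mat ::
  "complex ^ 'n ^ 'n \<Rightarrow> complex ^ 'c ^ 'n \<Rightarrow> complex ^ 'c ^ 'n \<Rightarrow> complex ^ 'c ^ 'c" where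
  "coarse_mat A P R = conj_transpose R ** A ** P"

definition Pi_proj ::
  "complex ^ 'n ^ 'n \<Rightarrow> complex ^ 'c ^ 'n \<Rightarrow> complex ^ 'c ^ 'n \<Rightarrow> complex ^ 'n ^ 'n" where
  "Pi_proj A P R = P ** matrix_inv (coarse_mat A P R) ** conj_transpose R ** A"

definition iter_mat :: "complex ^ 'n ^ 'n \<Rightarrow> complex ^ 'n ^ 'n \<Rightarrow> complex ^ 'n ^ 'n" where
  "iter_mat A M = mat 1 - matrix_inv M ** A"

definition two_grid ::
  "complex ^ 'n ^ 'n \<Rightarrow> complex ^ 'n ^ 'n \<Rightarrow> nat \<Rightarrow> nat \<Rightarrow>
    complex ^ 'c ^ 'n \<Rightarrow> complex ^ 'c ^ 'n \<Rightarrow> complex ^ 'n ^ 'n" where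
  "two_grid A M \<nu>\<^sub>1 \<nu>\<^sub>2 P R =
    mat_power (iter_mat A M) \<nu>\<^sub>2 ** (mat 1 - Pi_proj A P R) ** mat_power (iter_mat A M) \<nu>\<^sub>1"

end

theory Submission
  imports Defs
begin

text \<open>
  Write \<open>Q = I - \<Pi>\<^sub>A(P,R)\<close>, \<open>Q' = I - \<Pi>\<^sub>A(P',R')\<close> and \<open>N = (I - M\<^sup>-\<^sup>1A)\<^sup>\<nu>\<close>, and measure everything in
  the inner product \<open>\<langle>x,y\<rangle> = x\<^sup>H B y\<close>. Invertibility of \<open>R\<^sup>H A P\<close> makes
  \<open>\<Pi>\<^sub>A(P,R)\<close> a projection, likewise for \<open>P'\<close> and \<open>R'\<close>, and \<open>B\<close>-orthogonality makes
  \<open>Q\<close> and \<open>Q'\<close> orthogonal projections for this inner product.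

  Either inclusion of ranges says that the larger coarse space absorbs the smaller one: \<open>\<R>(P) \<subseteq> \<R>(P')\<close>
  nests the ranges of the coarse-grid projections, and \<open>\<R>(R) \<subseteq> \<R>(R')\<close> nests their kernels
  \<open>{x. R\<^sup>H A x = 0}\<close> in the opposite direction. For selfadjoint projections both mean the same,
  namely \<open>Q' = Q' Q = Q Q'\<close> (lemma \<open>Pi_proj_absorb\<close>).

  Since \<open>Q'\<close> is a contraction, \<open>\<parallel>Q' N\<parallel> = \<parallel>Q' Q N\<parallel> \<le> \<parallel>Q N\<parallel>\<close> and
  \<open>\<parallel>N Q'\<parallel> = \<parallel>N Q Q'\<parallel> \<le> \<parallel>N Q\<parallel>\<close>, which are the two one-sided cases.
  The symmetric case reduces to the first of them. As \<open>N\<close> is \<open>B\<close>-normal, \<open>N\<close> and its adjoint \<open>N\<^sup>+\<close>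
  lengthen every vector equally, so
  \<open>\<parallel>N Q N\<parallel> = \<parallel>N\<^sup>+ Q N\<parallel> = \<parallel>(Q N)\<^sup>+ (Q N)\<parallel> = \<parallel>Q N\<parallel>\<^sup>2\<close> (lemma \<open>mat_norm_B_normal_sandwich\<close>),
  and likewise for \<open>Q'\<close>.
\<close>

section \<open>Matrix algebra\<close>

lemma matrix_inv_inverse:
  fixes C :: "complex ^ 'n ^ 'n"
  assumes "invertible C"
  shows matrix_inv_right: "C ** matrix_inv C = mat 1"
    and matrix_inv_left: "matrix_inv C ** C = mat 1"
proof -
  have "C ** matrix_inv C = mat 1 \<and> matrix_inv C ** C = mat 1"
    using assms unfolding invertible_def matrix_inv_def by (rule someI_ex)
  then show "C ** matrix_inv C = mat 1" and "matrix_inv C ** C = mat 1" by auto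
qed

lemma diff_matrix_mult: "(C - D) ** X = C ** X - D ** X" for C D :: "complex ^ 'n ^ 'n"
  by (simp add: vec_eq_iff matrix_matrix_mult_def algebra_simps sum_subtractf)

lemma matrix_mult_diff: "X ** (C - D) = X ** C - X ** D" for C D :: "complex ^ 'n ^ 'n"
  by (simp add: vec_eq_iff matrix_matrix_mult_def algebra_simps sum_subtractf)

text \<open>
  Applied twice, this shows that powers of commuting matrices commute; with \<open>C = D\<close> it moves a factor
  of a power from the left end to the right end, which matching the reversed product of adjoints requires.
\<close>

lemma mat_power_comm:
  assumes "C ** D = D ** C"
  shows "C ** mat_power D k = mat_power D k ** C"
proof (induction k)
  case (Suc k)
  have "C ** (D ** mat_power D k) = D ** (C ** mat_power D k)"
    using assms by (simp add: matrix_mul_assoc)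
  with Suc show ?case by (simp add: matrix_mul_assoc)
qed simp

lemma conj_transpose_component: "conj_transpose C $ i $ j = cnj (C $ j $ i)"
  by (simp add: conj_transpose_def map_matrix_def transpose_def)

lemma conj_transpose_mult:
  "conj_transpose (C ** D) = conj_transpose D ** conj_transpose C"
  by (simp add: vec_eq_iff conj_transpose_component matrix_matrix_mult_def mult.commute)

text \<open>The columns of \<open>X\<close> are preimages under \<open>D\<close> of the columns of \<open>C\<close>.\<close>

lemma range_subset_imp_factor:
  fixes C :: "complex ^ 'c ^ 'n" and D :: "complex ^ 'd ^ 'n"
  assumes "range (\<lambda>y. C *v y) \<subseteq> range (\<lambda>y. D *v y)"
  obtains X where "C = D ** X"
proof -
  have "\<forall>j. \<exists>z. C *v axis j 1 = D *v z" using assms by blast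
  then obtain z where z: "\<And>j. C *v axis j 1 = D *v z j" by metis
  have "C = D ** (\<chi> i j. z j $ i)"
  proof (simp add: vec_eq_iff matrix_matrix_mult_def, intro allI)
    fix i j
    have "C $ i $ j = (C *v axis j 1) $ i"
      by (simp add: matrix_vector_mult_def axis_def if_distrib cong: if_cong)
    also have "\<dots> = (\<Sum>k\<in>UNIV. D $ i $ k * z j $ k)"
      unfolding z by (simp add: matrix_vector_mult_def)
    finally show "C $ i $ j = (\<Sum>k\<in>UNIV. D $ i $ k * z j $ k)" .
  qed
  then show thesis by (rule that)
qed

section \<open>The \<open>B\<close>-inner product\<close>

definition sform :: "complex ^ 'n ^ 'n \<Rightarrow> complex ^ 'n \<Rightarrow> complex ^ 'n \<Rightarrow> complex" where
  "sform B x y = (\<Sum>i\<in>UNIV. cnj (x $ i) * (B *v y) $ i)"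

lemma sesq_form_eq_sform: "sesq_form B x = sform B x x"
  by (simp add: sesq_form_def sform_def)

lemma sform_diff_left: "sform B (x - y) z = sform B x z - sform B y z"
  by (simp add: sform_def algebra_simps sum_subtractf)

lemma sform_diff_right: "sform B x (y - z) = sform B x y - sform B x z"
  by (simp add: sform_def algebra_simps sum_subtractf matrix_vector_mult_diff_distrib)

lemma sform_scale_left: "sform B (of_real r *s x) y = of_real r * sform B x y"
  by (simp add: sform_def sum_distrib_left mult_ac)

lemma sform_scale_right: "sform B x (of_real r *s y) = of_real r * sform B x y"
  by (simp add: sform_def sum_distrib_left mult_ac vector_scalar_commute)

lemma sum_conj_transpose_shift:
  "(\<Sum>i\<in>UNIV. cnj ((C *v x) $ i) * y $ i) = (\<Sum>j\<in>UNIV. cnj (x $ j) * (conj_transpose C *v y) $ j)"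
proof -
  have "(\<Sum>i\<in>UNIV. cnj ((C *v x) $ i) * y $ i)
      = (\<Sum>i\<in>UNIV. \<Sum>j\<in>UNIV. cnj (C $ i $ j) * cnj (x $ j) * y $ i)"
    by (simp add: matrix_vector_mult_def sum_distrib_right)
  also have "\<dots> = (\<Sum>j\<in>UNIV. \<Sum>i\<in>UNIV. cnj (C $ i $ j) * cnj (x $ j) * y $ i)"
    by (rule sum.swap)
  also have "\<dots> = (\<Sum>j\<in>UNIV. cnj (x $ j) * (conj_transpose C *v y) $ j)"
    by (simp add: matrix_vector_mult_def conj_transpose_component sum_distrib_left mult_ac)
  finally show ?thesis .
qed

lemma sform_commute:
  assumes "hermitian_pos_def B"
  shows "sform B y x = cnj (sform B x y)"
proof -
  have "conj_transpose B = B" using assms by (simp add: hermitian_pos_def_def)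
  then have "(\<Sum>i\<in>UNIV. cnj ((B *v y) $ i) * x $ i) = sform B y x"
    by (simp add: sum_conj_transpose_shift sform_def)
  then show ?thesis by (simp add: sform_def mult.commute)
qed

lemma Re_sform_self_nonneg:
  assumes "hermitian_pos_def B"
  shows "0 \<le> Re (sform B x x)"
proof (cases "x = 0")
  case True
  then show ?thesis by (simp add: sform_def)
next
  case False
  then show ?thesis
    using assms unfolding hermitian_pos_def_def sesq_form_eq_sform by force
qed

lemma Re_sform_self:
  assumes "hermitian_pos_def B"
  shows "Re (sform B x x) = (vec_norm_B B x)\<^sup>2"
  by (simp add: vec_norm_B_def sesq_form_eq_sform Re_sform_self_nonneg[OF assms])

lemma vec_norm_B_nonneg:
  assumes "hermitian_pos_def B"
  shows "0 \<le> vec_norm_B B x"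
  by (simp add: vec_norm_B_def sesq_form_eq_sform Re_sform_self_nonneg[OF assms])

lemma vec_norm_B_pos:
  assumes "hermitian_pos_def B" and "x \<noteq> 0"
  shows "0 < vec_norm_B B x"
  using assms by (simp add: vec_norm_B_def hermitian_pos_def_def)

lemma vec_norm_B_zero [simp]: "vec_norm_B B 0 = 0"
  by (simp add: vec_norm_B_def sesq_form_def)

text \<open>
  With \<open>a = \<langle>x,x\<rangle>\<close>, \<open>b = \<langle>y,y\<rangle>\<close> and \<open>r = Re \<langle>x,y\<rangle>\<close>, expand \<open>0 \<le> \<langle>bx - ry, bx - ry\<rangle> = b(ab - r\<^sup>2)\<close>. The
  real part is enough here, because it is only ever applied to products that equal a squared norm.
\<close>

lemma Cauchy_Schwarz_B:
  assumes B: "hermitian_pos_def B"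
  shows "Re (sform B x y) \<le> vec_norm_B B x * vec_norm_B B y"
proof (cases "y = 0")
  case True
  then show ?thesis by (simp add: sform_def)
next
  case False
  define a b r where "a = Re (sform B x x)" and "b = Re (sform B y y)" and "r = Re (sform B x y)"
  have sym: "Re (sform B y x) = r"
    using sform_commute[OF B, of y x] by (simp add: r_def)
  have b: "0 < b"
    using B False by (simp add: b_def hermitian_pos_def_def sesq_form_eq_sform)
  let ?z = "of_real b *s x - of_real r *s y"
  have "0 \<le> Re (sform B ?z ?z)" by (rule Re_sform_self_nonneg[OF B])
  also have "\<dots> = b * (a * b - r\<^sup>2)"
    using sym unfolding a_def b_def r_def
    by (simp add: sform_diff_left sform_diff_right sform_scale_left sform_scale_right
        algebra_simps power2_eq_square)
  finally have "r\<^sup>2 \<le> a * b" using b by (simp add: zero_le_mult_iff)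
  then have "r\<^sup>2 \<le> (vec_norm_B B x * vec_norm_B B y)\<^sup>2"
    by (simp add: a_def b_def Re_sform_self[OF B] power_mult_distrib)
  then show ?thesis
    unfolding r_def by (rule power2_le_imp_le) (simp add: vec_norm_B_nonneg[OF B])
qed

lemma sform_nondegenerate:
  assumes B: "hermitian_pos_def B" and eq: "\<And>x. sform B x y = sform B x z"
  shows "y = z"
proof (rule ccontr)
  assume "y \<noteq> z"
  then have "0 < Re (sform B (y - z) (y - z))"
    using B by (simp add: hermitian_pos_def_def sesq_form_eq_sform)
  then show False using eq by (simp add: sform_diff_right)
qed

section \<open>The induced matrix norm\<close>

lemma vec_norm_B_scale:
  assumes "hermitian_pos_def B"
  shows "vec_norm_B B (of_real r *s x) = \<bar>r\<bar> * vec_norm_B B x"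
proof -
  have "vec_norm_B B (of_real r *s x) = sqrt (r * (r * Re (sform B x x)))"
    by (simp add: vec_norm_B_def sesq_form_eq_sform sform_scale_left sform_scale_right)
  also have "\<dots> = \<bar>r\<bar> * sqrt (Re (sform B x x))"
    by (simp add: real_sqrt_mult flip: mult.assoc)
  finally show ?thesis by (simp add: vec_norm_B_def sesq_form_eq_sform)
qed

lemma continuous_on_vec_norm_B: "continuous_on S (\<lambda>x. vec_norm_B B (C *v x))"
  unfolding vec_norm_B_def sesq_form_def matrix_vector_mult_def
  by (intro continuous_intros)

text \<open>
  The quotient is invariant under scaling, so its values are those on the Euclidean unit sphere,
  where it is continuous. Boundedness is what makes the supremum in \<open>mat_norm_B\<close> meaningful.
\<close>

lemma bdd_above_norm_quotients:
  fixes B C :: "complex ^ 'n ^ 'n"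
  assumes B: "hermitian_pos_def B"
  shows "bdd_above ((\<lambda>x. vec_norm_B B (C *v x) / vec_norm_B B x) ` {x. x \<noteq> 0})"
proof -
  let ?f = "\<lambda>x :: complex ^ 'n. vec_norm_B B (C *v x) / vec_norm_B B x"
  have nz: "vec_norm_B B x \<noteq> 0" if "x \<in> sphere 0 1" for x
  proof -
    have "x \<noteq> 0" using that by auto
    then show ?thesis using vec_norm_B_pos[OF B] by (metis less_irrefl)
  qed
  have "continuous_on (sphere 0 1) (vec_norm_B B)"
    using continuous_on_vec_norm_B[of _ B "mat 1"] by simp
  then have "continuous_on (sphere 0 1) ?f"
    using nz by (intro continuous_on_divide continuous_on_vec_norm_B) auto
  then have "bounded (?f ` sphere 0 1)"
    by (intro compact_imp_bounded compact_continuous_image compact_sphere)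
  then have bdd: "bdd_above (?f ` sphere 0 1)"
    by (rule bounded_imp_bdd_above)
  have "?f ` {x. x \<noteq> 0} \<subseteq> ?f ` sphere 0 1"
  proof (rule image_subsetI)
    fix x :: "complex ^ 'n" assume "x \<in> {x. x \<noteq> 0}"
    then have x: "x \<noteq> 0" by simp
    define r where "r = inverse (norm x)"
    have r: "0 < r" using x by (simp add: r_def)
    have scale: "of_real r *s x = r *\<^sub>R x"
      by (simp add: vec_eq_iff scaleR_conv_of_real[where 'a=complex])
    have "norm (of_real r *s x) = 1"
      using x unfolding scale by (simp add: r_def)
    moreover have "?f (of_real r *s x) = ?f x"
      using r by (simp add: vec_norm_B_scale[OF B] vector_scalar_commute)
    ultimately show "?f x \<in> ?f ` sphere 0 1"
      by (intro image_eqI[of _ _ "of_real r *s x"]) auto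
  qed
  then show ?thesis using bdd by (rule bdd_above_mono[rotated])
qed

lemma vec_norm_B_le_mat_norm_B:
  assumes B: "hermitian_pos_def B"
  shows "vec_norm_B B (C *v x) \<le> mat_norm_B B C * vec_norm_B B x"
proof (cases "x = 0")
  case False
  then have "vec_norm_B B (C *v x) / vec_norm_B B x \<le> mat_norm_B B C"
    unfolding mat_norm_B_def
    by (intro cSUP_upper bdd_above_norm_quotients[OF B]) auto
  then show ?thesis using vec_norm_B_pos[OF B False] by (simp add: divide_le_eq)
qed simp

lemma mat_norm_B_le:
  fixes B C :: "complex ^ 'n ^ 'n"
  assumes B: "hermitian_pos_def B"
    and bound: "\<And>x. vec_norm_B B (C *v x) \<le> c * vec_norm_B B x"
  shows "mat_norm_B B C \<le> c"
  unfolding mat_norm_B_def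
proof (rule cSUP_least)
  have "axis undefined 1 \<noteq> (0 :: complex ^ 'n)" by (simp add: axis_eq_0_iff)
  then show "{x :: complex ^ 'n. x \<noteq> 0} \<noteq> {}" by blast
next
  fix x :: "complex ^ 'n" assume "x \<in> {x. x \<noteq> 0}"
  then show "vec_norm_B B (C *v x) / vec_norm_B B x \<le> c"
    using vec_norm_B_pos[OF B] bound by (simp add: divide_le_eq)
qed

lemma mat_norm_B_nonneg:
  fixes B C :: "complex ^ 'n ^ 'n"
  assumes B: "hermitian_pos_def B"
  shows "0 \<le> mat_norm_B B C"
proof -
  define e :: "complex ^ 'n" where "e = axis undefined 1"
  have "e \<noteq> 0" by (simp add: e_def axis_eq_0_iff)
  then have "0 < vec_norm_B B e" by (rule vec_norm_B_pos[OF B])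
  moreover have "0 \<le> mat_norm_B B C * vec_norm_B B e"
    using vec_norm_B_nonneg[OF B] vec_norm_B_le_mat_norm_B[OF B] by (rule order_trans)
  ultimately show ?thesis by (simp add: zero_le_mult_iff)
qed

lemma mat_norm_B_mult_le:
  assumes B: "hermitian_pos_def B"
  shows "mat_norm_B B (C ** D) \<le> mat_norm_B B C * mat_norm_B B D"
proof (rule mat_norm_B_le[OF B])
  fix x
  have "vec_norm_B B (C *v (D *v x)) \<le> mat_norm_B B C * vec_norm_B B (D *v x)"
    by (rule vec_norm_B_le_mat_norm_B[OF B])
  also have "\<dots> \<le> mat_norm_B B C * (mat_norm_B B D * vec_norm_B B x)"
    by (intro mult_left_mono vec_norm_B_le_mat_norm_B[OF B] mat_norm_B_nonneg[OF B])
  finally show "vec_norm_B B ((C ** D) *v x) \<le> mat_norm_B B C * mat_norm_B B D * vec_norm_B B x"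
    by (simp add: matrix_vector_mul_assoc mult.assoc)
qed

section \<open>Adjoints\<close>

text \<open>
  Being adjoint is stated as a relation, so that differences, products and powers of adjoints can be formed
  without computing with \<open>matrix_inv B\<close>; \<open>adjoint_B\<close> enters only through \<open>adjoint_pair_adjoint_B\<close>.
\<close>

definition adjoint_pair :: "complex ^ 'n ^ 'n \<Rightarrow> complex ^ 'n ^ 'n \<Rightarrow> complex ^ 'n ^ 'n \<Rightarrow> bool" where
  "adjoint_pair B C D \<longleftrightarrow> (\<forall>x y. sform B (C *v x) y = sform B x (D *v y))"

lemma adjoint_pairD: "adjoint_pair B C D \<Longrightarrow> sform B (C *v x) y = sform B x (D *v y)"
  by (simp add: adjoint_pair_def)

text \<open>
  A kernel vector \<open>x\<close> would have \<open>x\<^sup>H B x = 0\<close>. Invertibility of \<open>B\<close> is needed because \<open>adjoint_B\<close>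
  is defined through \<open>matrix_inv B\<close>.
\<close>

lemma invertible_hermitian_pos_def:
  assumes B: "hermitian_pos_def B"
  shows "invertible B"
proof -
  have "x = 0" if "B *v x = 0" for x
  proof (rule ccontr)
    assume "x \<noteq> 0"
    then have "0 < Re (sesq_form B x)" using B by (simp add: hermitian_pos_def_def)
    then show False using that by (simp add: sesq_form_def)
  qed
  then show ?thesis
    by (simp add: invertible_left_inverse matrix_left_invertible_ker)
qed

lemma adjoint_pair_adjoint_B:
  assumes B: "hermitian_pos_def B"
  shows "adjoint_pair B C (adjoint_B B C)"
  unfolding adjoint_pair_def
proof (intro allI)
  fix x y
  have "B ** adjoint_B B C = (B ** matrix_inv B) ** conj_transpose C ** B"
    by (simp add: adjoint_B_def matrix_mul_assoc)
  also have "\<dots> = conj_transpose C ** B"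
    by (simp add: matrix_inv_right[OF invertible_hermitian_pos_def[OF B]])
  finally have "B *v (adjoint_B B C *v y) = conj_transpose C *v (B *v y)"
    by (simp add: matrix_vector_mul_assoc)
  then show "sform B (C *v x) y = sform B x (adjoint_B B C *v y)"
    by (simp add: sform_def sum_conj_transpose_shift)
qed

lemma adjoint_pair_sym:
  assumes "hermitian_pos_def B" and "adjoint_pair B C D"
  shows "adjoint_pair B D C"
  using assms unfolding adjoint_pair_def by (metis sform_commute)

lemma adjoint_pair_mat_1: "adjoint_pair B (mat 1) (mat 1)"
  by (simp add: adjoint_pair_def)

lemma adjoint_pair_diff:
  "adjoint_pair B C D \<Longrightarrow> adjoint_pair B C' D' \<Longrightarrow> adjoint_pair B (C - C') (D - D')"
  by (simp add: adjoint_pair_def matrix_vector_mult_diff_rdistrib sform_diff_left sform_diff_right)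

lemma adjoint_pair_mult:
  "adjoint_pair B C D \<Longrightarrow> adjoint_pair B C' D' \<Longrightarrow> adjoint_pair B (C ** C') (D' ** D)"
  by (simp add: adjoint_pair_def flip: matrix_vector_mul_assoc)

lemma adjoint_pair_unique:
  assumes B: "hermitian_pos_def B" and "adjoint_pair B C D" and "adjoint_pair B C D'"
  shows "D = D'"
proof -
  have "D *v y = D' *v y" for y
    by (rule sform_nondegenerate[OF B]) (metis assms(2,3) adjoint_pairD)
  then show ?thesis by (simp add: matrix_eq)
qed

lemma adjoint_pair_mat_power:
  assumes "adjoint_pair B C D"
  shows "adjoint_pair B (mat_power C k) (mat_power D k)"
proof (induction k)
  case (Suc k)
  show ?case
    using adjoint_pair_mult[OF assms Suc] by (simp add: mat_power_comm[OF refl])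
qed (simp add: adjoint_pair_mat_1)

text \<open>
  Both squared norms equal \<open>\<langle>x, N' N x\<rangle> = \<langle>x, N N' x\<rangle>\<close>.
\<close>

lemma vec_norm_B_normal:
  assumes B: "hermitian_pos_def B" and pair: "adjoint_pair B N N'"
    and comm: "N ** N' = N' ** N"
  shows "vec_norm_B B (N *v x) = vec_norm_B B (N' *v x)"
proof -
  have "sform B (N *v x) (N *v x) = sform B x ((N' ** N) *v x)"
    by (simp add: adjoint_pairD[OF pair] flip: matrix_vector_mul_assoc)
  also have "\<dots> = sform B x (N *v (N' *v x))"
    by (simp add: matrix_vector_mul_assoc comm)
  also have "\<dots> = sform B (N' *v x) (N' *v x)"
    by (simp add: adjoint_pairD[OF adjoint_pair_sym[OF B pair]])
  finally show ?thesis by (simp add: vec_norm_B_def sesq_form_eq_sform)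
qed

text \<open>
  Duality: \<open>\<parallel>D y\<parallel>\<^sup>2 = \<langle>C D y, y\<rangle> \<le> \<parallel>C\<parallel> \<parallel>D y\<parallel> \<parallel>y\<parallel>\<close>, then cancel \<open>\<parallel>D y\<parallel>\<close>.
\<close>

lemma mat_norm_B_adjoint_le:
  assumes B: "hermitian_pos_def B" and pair: "adjoint_pair B C D"
  shows "mat_norm_B B D \<le> mat_norm_B B C"
proof (rule mat_norm_B_le[OF B])
  fix y
  let ?w = "D *v y" and ?c = "mat_norm_B B C"
  have "(vec_norm_B B ?w)\<^sup>2 = Re (sform B (C *v ?w) y)"
    by (simp add: adjoint_pairD[OF pair] Re_sform_self[OF B])
  also have "\<dots> \<le> vec_norm_B B (C *v ?w) * vec_norm_B B y"
    by (rule Cauchy_Schwarz_B[OF B])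
  also have "\<dots> \<le> ?c * vec_norm_B B ?w * vec_norm_B B y"
    by (intro mult_right_mono vec_norm_B_le_mat_norm_B vec_norm_B_nonneg B)
  finally have "vec_norm_B B ?w * vec_norm_B B ?w \<le> vec_norm_B B ?w * (?c * vec_norm_B B y)"
    by (simp add: power2_eq_square mult_ac)
  then show "vec_norm_B B ?w \<le> ?c * vec_norm_B B y"
    using vec_norm_B_nonneg[OF B, of ?w] mat_norm_B_nonneg[OF B, of C] vec_norm_B_nonneg[OF B, of y]
    by (cases "vec_norm_B B ?w = 0") (auto simp: mult_le_cancel_left)
qed

text \<open>
  Cauchy-Schwarz on \<open>\<parallel>Q x\<parallel>\<^sup>2 = \<langle>x, Q x\<rangle>\<close>.
\<close>

lemma mat_norm_B_projection_le_1:
  assumes B: "hermitian_pos_def B" and pair: "adjoint_pair B Q Q" and idem: "Q ** Q = Q"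
  shows "mat_norm_B B Q \<le> 1"
proof (rule mat_norm_B_le[OF B])
  fix x
  have "(vec_norm_B B (Q *v x))\<^sup>2 = Re (sform B x (Q *v x))"
    by (simp add: adjoint_pairD[OF pair] matrix_vector_mul_assoc idem flip: Re_sform_self[OF B])
  also have "\<dots> \<le> vec_norm_B B x * vec_norm_B B (Q *v x)"
    by (rule Cauchy_Schwarz_B[OF B])
  finally show "vec_norm_B B (Q *v x) \<le> 1 * vec_norm_B B x"
    using vec_norm_B_nonneg[OF B, of x] vec_norm_B_nonneg[OF B, of "Q *v x"]
    by (cases "vec_norm_B B (Q *v x) = 0") (auto simp: power2_eq_square)
qed

text \<open>
  This is the C*-identity for \<open>Q N\<close>, whose adjoint is \<open>N\<^sup>+ Q\<close>: normality lets the leftmost factor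
  \<open>N\<close> be traded for \<open>N\<^sup>+ = N'\<close> without changing any norm, and \<open>N\<^sup>+ Q N = (N\<^sup>+ Q) (Q N)\<close>.
\<close>

lemma mat_norm_B_normal_sandwich:
  assumes B: "hermitian_pos_def B"
    and N: "adjoint_pair B N N'" and comm: "N ** N' = N' ** N"
    and Q: "adjoint_pair B Q Q" and idem: "Q ** Q = Q"
  shows "mat_norm_B B (N ** Q ** N) = (mat_norm_B B (Q ** N))\<^sup>2"
proof (rule antisym)
  let ?c = "mat_norm_B B (N ** Q ** N)" and ?d = "mat_norm_B B (Q ** N)"
  have swap: "vec_norm_B B ((N ** Q ** N) *v x) = vec_norm_B B (N' *v (Q *v (N *v x)))" for x
    using vec_norm_B_normal[OF B N comm] by (simp flip: matrix_vector_mul_assoc)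
  show "?c \<le> ?d\<^sup>2"
  proof (rule mat_norm_B_le[OF B])
    fix x
    have "vec_norm_B B ((N ** Q ** N) *v x) = vec_norm_B B (((N' ** Q) ** (Q ** N)) *v x)"
      unfolding swap by (simp add: matrix_vector_mul_assoc matrix_mul_assoc)
        (metis idem matrix_mul_assoc)
    also have "\<dots> \<le> mat_norm_B B ((N' ** Q) ** (Q ** N)) * vec_norm_B B x"
      by (rule vec_norm_B_le_mat_norm_B[OF B])
    also have "mat_norm_B B ((N' ** Q) ** (Q ** N)) \<le> mat_norm_B B (N' ** Q) * ?d"
      by (rule mat_norm_B_mult_le[OF B])
    also have "\<dots> \<le> ?d * ?d"
      using mat_norm_B_adjoint_le[OF B adjoint_pair_mult[OF Q N]]
      by (rule mult_right_mono) (rule mat_norm_B_nonneg[OF B])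
    finally show "vec_norm_B B ((N ** Q ** N) *v x) \<le> ?d\<^sup>2 * vec_norm_B B x"
      by (simp add: power2_eq_square mult_right_mono vec_norm_B_nonneg[OF B])
  qed
  \<comment> \<open>Conversely, \<open>\<parallel>Q N x\<parallel>\<^sup>2 = \<langle>x, N\<^sup>+ Q N x\<rangle> \<le> \<parallel>x\<parallel> \<parallel>N Q N x\<parallel>\<close>.\<close>
  have "?d \<le> sqrt ?c"
  proof (rule mat_norm_B_le[OF B])
    fix x
    let ?u = "(Q ** N) *v x"
    have "Re (sform B ?u ?u) = Re (sform B x (N' *v (Q *v (Q *v (N *v x)))))"
      by (simp add: adjoint_pairD[OF N] adjoint_pairD[OF Q] flip: matrix_vector_mul_assoc)
    also have "\<dots> = Re (sform B x (N' *v (Q *v (N *v x))))"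
      using idem by (metis matrix_vector_mul_assoc)
    also have "\<dots> \<le> vec_norm_B B x * vec_norm_B B (N' *v (Q *v (N *v x)))"
      by (rule Cauchy_Schwarz_B[OF B])
    also have "\<dots> \<le> vec_norm_B B x * (?c * vec_norm_B B x)"
      unfolding swap[symmetric]
      by (intro mult_left_mono vec_norm_B_le_mat_norm_B vec_norm_B_nonneg B)
    finally have "(vec_norm_B B ?u)\<^sup>2 \<le> (sqrt ?c * vec_norm_B B x)\<^sup>2"
      by (simp add: Re_sform_self[OF B] power_mult_distrib mat_norm_B_nonneg[OF B])
        (simp add: power2_eq_square mult_ac)
    then show "vec_norm_B B ?u \<le> sqrt ?c * vec_norm_B B x"
      by (rule power2_le_imp_le) (simp add: vec_norm_B_nonneg[OF B] mat_norm_B_nonneg[OF B])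
  qed
  then have "?d\<^sup>2 \<le> (sqrt ?c)\<^sup>2"
    by (rule power_mono) (rule mat_norm_B_nonneg[OF B])
  then show "?d\<^sup>2 \<le> ?c" by (simp add: mat_norm_B_nonneg[OF B])
qed

section \<open>Coarse-grid projections\<close>

lemma Pi_proj_fixes_P:
  assumes "invertible (coarse_mat A P R)"
  shows "Pi_proj A P R ** P = P"
proof -
  have "Pi_proj A P R ** P = P ** (matrix_inv (coarse_mat A P R) ** coarse_mat A P R)"
    by (simp add: Pi_proj_def coarse_mat_def matrix_mul_assoc)
  then show ?thesis by (simp add: matrix_inv_left[OF assms])
qed

text \<open>
  The rows of \<open>R\<^sup>H A\<close> are the functionals whose common kernel is the kernel of \<open>\<Pi>\<^sub>A(P,R)\<close>; the
  correction \<open>I - \<Pi>\<^sub>A(P,R)\<close> maps into that kernel.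
\<close>

lemma Pi_proj_preserves_tests:
  assumes "invertible (coarse_mat A P R)"
  shows "conj_transpose R ** A ** Pi_proj A P R = conj_transpose R ** A"
proof -
  have "conj_transpose R ** A ** Pi_proj A P R =
      (coarse_mat A P R ** matrix_inv (coarse_mat A P R)) ** (conj_transpose R ** A)"
    by (simp add: Pi_proj_def coarse_mat_def matrix_mul_assoc)
  then show ?thesis by (simp add: matrix_inv_right[OF assms])
qed

text \<open>
  \<open>\<Pi>\<^sub>A(P',R')\<close> fixes the columns of \<open>P'\<close>, hence those of \<open>P = P' X\<close>, whose span contains the
  range of \<open>\<Pi>\<^sub>A(P,R)\<close>.
\<close>

lemma Pi_proj_range_absorb:
  assumes inv: "invertible (coarse_mat A P' R')"
    and "range (\<lambda>y. P *v y) \<subseteq> range (\<lambda>y. P' *v y)"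
  shows "Pi_proj A P' R' ** Pi_proj A P R = Pi_proj A P R"
proof -
  obtain X where X: "P = P' ** X" using range_subset_imp_factor[OF assms(2)] .
  have "Pi_proj A P' R' ** P = P"
    using Pi_proj_fixes_P[OF inv] by (simp add: X matrix_mul_assoc)
  then show ?thesis
    by (simp add: Pi_proj_def[of A P R] matrix_mul_assoc)
qed

text \<open>
  \<open>\<Pi>\<^sub>A(P',R')\<close> leaves \<open>R'\<^sup>H A\<close> unchanged, hence also \<open>R\<^sup>H A = X\<^sup>H R'\<^sup>H A\<close>, and
  \<open>\<Pi>\<^sub>A(P,R) x\<close> depends on \<open>x\<close> only through \<open>R\<^sup>H A x\<close>.
\<close>

lemma Pi_proj_kernel_absorb:
  assumes inv: "invertible (coarse_mat A P' R')"
    and "range (\<lambda>y. R *v y) \<subseteq> range (\<lambda>y. R' *v y)"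
  shows "Pi_proj A P R ** Pi_proj A P' R' = Pi_proj A P R"
proof -
  obtain X where X: "R = R' ** X" using range_subset_imp_factor[OF assms(2)] .
  have "conj_transpose R ** A ** Pi_proj A P' R' =
      conj_transpose X ** (conj_transpose R' ** A ** Pi_proj A P' R')"
    by (simp add: X conj_transpose_mult matrix_mul_assoc)
  also have "\<dots> = conj_transpose R ** A"
    by (simp add: Pi_proj_preserves_tests[OF inv] X conj_transpose_mult matrix_mul_assoc)
  finally have fix_R: "conj_transpose R ** A ** Pi_proj A P' R' = conj_transpose R ** A" .
  have "Pi_proj A P R ** Pi_proj A P' R' =
      P ** matrix_inv (coarse_mat A P R) ** (conj_transpose R ** A ** Pi_proj A P' R')"
    by (simp add: Pi_proj_def[of A P R] matrix_mul_assoc)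
  then show ?thesis unfolding fix_R by (simp add: Pi_proj_def matrix_mul_assoc)
qed

text \<open>
  Each inclusion gives one of the two identities; taking adjoints of selfadjoint projections
  interchanges them.
\<close>

lemma Pi_proj_absorb:
  assumes B: "hermitian_pos_def B"
    and inv: "invertible (coarse_mat A P' R')"
    and sa: "adjoint_pair B (Pi_proj A P R) (Pi_proj A P R)"
    and sa': "adjoint_pair B (Pi_proj A P' R') (Pi_proj A P' R')"
    and "range (\<lambda>y. R *v y) \<subseteq> range (\<lambda>y. R' *v y) \<or> range (\<lambda>y. P *v y) \<subseteq> range (\<lambda>y. P' *v y)"
  shows "Pi_proj A P R ** Pi_proj A P' R' = Pi_proj A P R"
    and "Pi_proj A P' R' ** Pi_proj A P R = Pi_proj A P R"
proof -
  let ?p = "Pi_proj A P R" and ?p' = "Pi_proj A P' R'"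
  have "?p ** ?p' = ?p \<or> ?p' ** ?p = ?p"
    using assms(5) Pi_proj_kernel_absorb[OF inv] Pi_proj_range_absorb[OF inv] by blast
  moreover have "?p ** ?p' = ?p \<longleftrightarrow> ?p' ** ?p = ?p"
    using adjoint_pair_mult[OF sa sa'] adjoint_pair_mult[OF sa' sa] sa
      adjoint_pair_unique[OF B] by metis
  ultimately show "?p ** ?p' = ?p" and "?p' ** ?p = ?p" by blast+
qed

theorem theorem3p21:
  fixes A M B :: "complex ^ 'n ^ 'n"
    and P R :: "complex ^ 'c ^ 'n"
    and P' R' :: "complex ^ 'd ^ 'n"
    and \<nu> \<nu>\<^sub>1 \<nu>\<^sub>2 :: nat
  assumes "invertible A" and "invertible M" and "hermitian_pos_def B"
    and "mat_norm_B B (mat 1 - matrix_inv M ** A) < 1"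
    and "normal_B B (matrix_inv M ** A)"
    and "invertible (mat 1 - matrix_inv M ** A)"
    and "1 \<le> \<nu>"
    and "CARD('c) \<le> CARD('d)" and "CARD('d) < CARD('n)"
    and "invertible (coarse_mat A P R)" and "invertible (coarse_mat A P' R')"
    and "orthogonal_B B (Pi_proj A P R)" and "orthogonal_B B (Pi_proj A P' R')"
    and "range (\<lambda>y. R *v y) \<subseteq> range (\<lambda>y. R' *v y) \<or> range (\<lambda>y. P *v y) \<subseteq> range (\<lambda>y. P' *v y)"
    and "(\<nu>\<^sub>1, \<nu>\<^sub>2) \<in> {(\<nu>, 0), (0, \<nu>), (\<nu>, \<nu>)}"
  shows "mat_norm_B B (two_grid A M \<nu>\<^sub>1 \<nu>\<^sub>2 P' R') \<le> mat_norm_B B (two_grid A M \<nu>\<^sub>1 \<nu>\<^sub>2 P R)"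
proof -
  note B = assms(3)
  define T where "T = matrix_inv M ** A"
  define N N' where "N = mat_power (mat 1 - T) \<nu>" and "N' = mat_power (mat 1 - adjoint_B B T) \<nu>"
  define Q Q' where "Q = mat 1 - Pi_proj A P R" and "Q' = mat 1 - Pi_proj A P' R'"

  have sa: "adjoint_pair B (Pi_proj A P R) (Pi_proj A P R)"
    and sa': "adjoint_pair B (Pi_proj A P' R') (Pi_proj A P' R')"
    using adjoint_pair_adjoint_B[OF B] assms(12,13) unfolding orthogonal_B_def by metis+
  have Q: "adjoint_pair B Q Q" and Q': "adjoint_pair B Q' Q'"
    unfolding Q_def Q'_def by (intro adjoint_pair_diff adjoint_pair_mat_1 sa sa')+
  have idem: "Pi_proj A P R ** Pi_proj A P R = Pi_proj A P R"
    and idem': "Pi_proj A P' R' ** Pi_proj A P' R' = Pi_proj A P' R'"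
    using Pi_proj_range_absorb[OF assms(10) subset_refl]
      Pi_proj_range_absorb[OF assms(11) subset_refl] .
  note absorb = Pi_proj_absorb[OF B assms(11) sa sa' assms(14)]
  have QQ: "Q ** Q = Q" "Q' ** Q' = Q'" and Q'Q: "Q' ** Q = Q'" and QQ': "Q ** Q' = Q'"
    unfolding Q_def Q'_def
    by (simp_all add: diff_matrix_mult matrix_mult_diff idem idem' absorb)
  have le1: "mat_norm_B B Q' \<le> 1"
    by (rule mat_norm_B_projection_le_1[OF B Q' QQ(2)])

  have N: "adjoint_pair B N N'"
    unfolding N_def N'_def
    by (intro adjoint_pair_mat_power adjoint_pair_diff adjoint_pair_mat_1 adjoint_pair_adjoint_B[OF B])
  \<comment> \<open>Normality of \<open>M\<^sup>-\<^sup>1A\<close> passes to \<open>I - M\<^sup>-\<^sup>1A\<close> and then to its powers.\<close>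
  have "(mat 1 - T) ** (mat 1 - adjoint_B B T) = (mat 1 - adjoint_B B T) ** (mat 1 - T)"
    using assms(5) unfolding normal_B_def T_def[symmetric]
    by (simp add: diff_matrix_mult matrix_mult_diff)
  then have comm: "N ** N' = N' ** N"
    unfolding N_def N'_def by (metis mat_power_comm)

  have left: "mat_norm_B B (Q' ** N) \<le> mat_norm_B B (Q ** N)"
  proof -
    have "mat_norm_B B (Q' ** N) = mat_norm_B B (Q' ** (Q ** N))"
      by (simp add: matrix_mul_assoc Q'Q)
    also have "\<dots> \<le> mat_norm_B B Q' * mat_norm_B B (Q ** N)"
      by (rule mat_norm_B_mult_le[OF B])
    also have "\<dots> \<le> 1 * mat_norm_B B (Q ** N)"
      by (intro mult_right_mono le1 mat_norm_B_nonneg[OF B])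
    finally show ?thesis by simp
  qed
  have right: "mat_norm_B B (N ** Q') \<le> mat_norm_B B (N ** Q)"
  proof -
    have "mat_norm_B B (N ** Q') = mat_norm_B B ((N ** Q) ** Q')"
      by (simp add: QQ' flip: matrix_mul_assoc)
    also have "\<dots> \<le> mat_norm_B B (N ** Q) * mat_norm_B B Q'"
      by (rule mat_norm_B_mult_le[OF B])
    also have "\<dots> \<le> mat_norm_B B (N ** Q) * 1"
      by (intro mult_left_mono le1 mat_norm_B_nonneg[OF B])
    finally show ?thesis by simp
  qed
  have both: "mat_norm_B B (N ** Q' ** N) \<le> mat_norm_B B (N ** Q ** N)"
    unfolding mat_norm_B_normal_sandwich[OF B N comm Q QQ(1)]
      mat_norm_B_normal_sandwich[OF B N comm Q' QQ(2)]
    by (intro power_mono left mat_norm_B_nonneg[OF B])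

  from assms(15) show ?thesis
    using left right both
    by (auto simp: two_grid_def iter_mat_def N_def Q_def Q'_def T_def)
qed

end
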